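(* Let $\alpha>0$, $J_n=n^{-(1+\alpha)}$ for $n\ge1$, $J=\sum_{n\ge1}J_n=\zeta(1+\alpha)$, and $\epsilon,\omega_A,\omega_B>0$. Define $$q_0=\sqrt{\omega_A+2\epsilon J},\qquad q_n=\frac{\epsilon\left(J_nq_0+\sum_{m=1}^{n-1}(J_{n-m}+J_{n+m})q_m\right)}{\epsilon(2J-J_{2n})+\omega_A}\quad(n\ge1),\qquad q_{-n}=q_n,$$ $$g_1=g_0=\sqrt{\omega_B+\epsilon(2J-J_1)},\qquad g_n=\frac{\epsilon\sum_{m=1}^{n-1}(J_{n-m}+J_{n+m-1})g_m}{\epsilon(2J-J_{2n-1})+\omega_B}\quad(n\ge2),\qquad g_n=g_{-(n-1)} .$$ Let $E_A=E[q]$ and $E_B=E[g]$, where $E[u]=\frac{\epsilon}{4}\sum_{n\neq m}\frac{|u_n-u_m|^2}{|n-m|^{1+\alpha}}-\frac14\sum_{n\in\mathbb{Z}}|u_n|^4$. Then $$E_A=\epsilon\sum_{n=1}^\infty\left(\frac{|q_n-q_0|^2}{n^{1+\alpha}}+\frac12\sum_{m\ge 1,\, m\ne n}\left(\frac1{|n-m|^{1+\alpha}}+\frac1{|n+m|^{1+\alpha}}\right)|q_n-q_m|^2\right)-\left(\frac14q_0^4+\frac12\sum_{n=1}^\infty q_n^4\right),$$ $$E_B=\epsilon\sum_{n=2}^\infty\left(\left(\frac1{n^{1+\alpha}}+\frac1{(n-1)^{1+\alpha}}\right)|g_n-g_0|^2+\frac12\sum_{m\ge 2,\, m\ne n}\left(\frac1{|n-m|^{1+\alpha}}+\frac1{|n+m-1|^{1+\alpha}}\right)|g_n-g_m|^2\right)-\frac12\sum_{n=1}^\infty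 g_n^4 .$$
   Context: In $E[u]$ the double sum is over ordered pairs $(n,m)\in\mathbb{Z}^2$ with $n\ne m$. $\zeta$ is the Riemann zeta function. *)

theory Defs
  imports "HOL-Analysis.Analysis"
begin

definition coupling :: "real \<Rightarrow> int \<Rightarrow> real" where
  "coupling \<alpha> n = real_of_int n powr (- (1 + \<alpha>))"

(* The Dirichlet series of the Riemann zeta function at 1 + \<alpha>, which is convergent for \<alpha> > 0. *)
definition coupling_total :: "real \<Rightarrow> real" where
  "coupling_total \<alpha> = (\<Sum>\<^sub>\<infinity>n\<in>{1..}. coupling \<alpha> n)"

(* The recursions run over the integers, so that the reflections q(-n) = q(n) and
   g(n) = g(-(n - 1)) are part of the definitions; see the lemmas below. *)
function on_site :: "real \<Rightarrow> real \<Rightarrow> real \<Rightarrow> int \<Rightarrow> real" where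
  "on_site \<alpha> \<epsilon> \<omega> n =
    (if n < 0 then on_site \<alpha> \<epsilon> \<omega> (- n)
     else if n = 0 then sqrt (\<omega> + 2 * \<epsilon> * coupling_total \<alpha>)
     else \<epsilon> * (coupling \<alpha> n * on_site \<alpha> \<epsilon> \<omega> 0
               + (\<Sum>m\<in>{1..n - 1}. (coupling \<alpha> (n - m) + coupling \<alpha> (n + m)) * on_site \<alpha> \<epsilon> \<omega> m))
          / (\<epsilon> * (2 * coupling_total \<alpha> - coupling \<alpha> (2 * n)) + \<omega>))"
  by pat_completeness auto
termination
  by (relation "Wellfounded.measure (\<lambda>(\<alpha>, \<epsilon>, \<omega>, n). nat (if n < 0 then 1 - n else n))") auto

function off_site :: "real \<Rightarrow> real \<Rightarrow> real \<Rightarrow> int \<Rightarrow> real" where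
  "off_site \<alpha> \<epsilon> \<omega> n =
    (if n \<le> 0 then off_site \<alpha> \<epsilon> \<omega> (1 - n)
     else if n = 1 then sqrt (\<omega> + \<epsilon> * (2 * coupling_total \<alpha> - coupling \<alpha> 1))
     else \<epsilon> * (\<Sum>m\<in>{1..n - 1}. (coupling \<alpha> (n - m) + coupling \<alpha> (n + m - 1)) * off_site \<alpha> \<epsilon> \<omega> m)
          / (\<epsilon> * (2 * coupling_total \<alpha> - coupling \<alpha> (2 * n - 1)) + \<omega>))"
  by pat_completeness auto
termination
  by (relation "Wellfounded.measure (\<lambda>(\<alpha>, \<epsilon>, \<omega>, n). nat (if n \<le> 0 then 2 - n else n))") auto

declare on_site.simps [simp del] off_site.simps [simp del]

lemma on_site_0:
  "on_site \<alpha> \<epsilon> \<omega> 0 = sqrt (\<omega> + 2 * \<epsilon> * coupling_total \<alpha>)"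
  by (simp add: on_site.simps)

lemma on_site_pos:
  assumes "n \<ge> 1"
  shows "on_site \<alpha> \<epsilon> \<omega> n =
    \<epsilon> * (coupling \<alpha> n * on_site \<alpha> \<epsilon> \<omega> 0
         + (\<Sum>m\<in>{1..n - 1}. (coupling \<alpha> (n - m) + coupling \<alpha> (n + m)) * on_site \<alpha> \<epsilon> \<omega> m))
    / (\<epsilon> * (2 * coupling_total \<alpha> - coupling \<alpha> (2 * n)) + \<omega>)"
  using assms by (subst on_site.simps) simp

lemma on_site_minus: "on_site \<alpha> \<epsilon> \<omega> (- n) = on_site \<alpha> \<epsilon> \<omega> n"
proof (cases n "0 :: int" rule: linorder_cases)
  case less
  then show ?thesis by (subst (2) on_site.simps) simp
next
  case greater
  then show ?thesis by (subst on_site.simps) simp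
qed simp

lemma off_site_1:
  "off_site \<alpha> \<epsilon> \<omega> 1 = sqrt (\<omega> + \<epsilon> * (2 * coupling_total \<alpha> - coupling \<alpha> 1))"
  by (simp add: off_site.simps)

lemma off_site_ge_2:
  assumes "n \<ge> 2"
  shows "off_site \<alpha> \<epsilon> \<omega> n =
    \<epsilon> * (\<Sum>m\<in>{1..n - 1}. (coupling \<alpha> (n - m) + coupling \<alpha> (n + m - 1)) * off_site \<alpha> \<epsilon> \<omega> m)
    / (\<epsilon> * (2 * coupling_total \<alpha> - coupling \<alpha> (2 * n - 1)) + \<omega>)"
  using assms by (subst off_site.simps) simp

lemma off_site_reflect: "off_site \<alpha> \<epsilon> \<omega> n = off_site \<alpha> \<epsilon> \<omega> (- (n - 1))"
proof (cases "n \<le> 0")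
  case True
  then show ?thesis by (subst off_site.simps) simp
next
  case False
  then show ?thesis by (subst (2) off_site.simps) simp
qed

lemma off_site_0: "off_site \<alpha> \<epsilon> \<omega> 0 = off_site \<alpha> \<epsilon> \<omega> 1"
  by (subst off_site.simps) simp

definition energy :: "real \<Rightarrow> real \<Rightarrow> (int \<Rightarrow> real) \<Rightarrow> real" where
  "energy \<alpha> \<epsilon> u =
    \<epsilon> / 4 * (\<Sum>\<^sub>\<infinity>(n, m)\<in>{(n, m). n \<noteq> m}. \<bar>u n - u m\<bar>\<^sup>2 / real_of_int \<bar>n - m\<bar> powr (1 + \<alpha>))
    - 1 / 4 * (\<Sum>\<^sub>\<infinity>n. \<bar>u n\<bar> ^ 4)"

(* infsum is 0 for a divergent series; this predicate says that energy takes no such default value. *)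
definition energy_converges :: "real \<Rightarrow> (int \<Rightarrow> real) \<Rightarrow> bool" where
  "energy_converges \<alpha> u \<longleftrightarrow>
    (\<lambda>(n, m). \<bar>u n - u m\<bar>\<^sup>2 / real_of_int \<bar>n - m\<bar> powr (1 + \<alpha>)) summable_on {(n, m). n \<noteq> m}
    \<and> (\<lambda>n. \<bar>u n\<bar> ^ 4) summable_on UNIV"

end

theory Submission
  imports Defs
begin

text \<open>
  Both sequences are symmetric under \<open>n \<mapsto> c - n\<close>, with \<open>c = 0\<close> for \<open>q\<close> and \<open>c = 1\<close> for \<open>g\<close>.
  When the recursion is summed over finitely many sites, the value at \<open>m\<close> receives on the right
  at most \<open>J\<close> from the couplings \<open>J (n - m)\<close> and at most \<open>J - J (2 m - c)\<close> from the couplings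
  \<open>J (n + m - c)\<close> with \<open>n > m\<close>, which is the coefficient of \<open>\<epsilon>\<close> it carries on the left.  Hence
  \<open>\<omega>\<close> times the sum of the values is bounded, both sequences are summable and the double series
  converges absolutely.  Fubini's theorem and the symmetry then fold the energy onto the positive
  half-line.
\<close>

section \<open>Sums over the integers folded at a reflection\<close>

text \<open>The map taking \<open>n\<close> to \<open>c - n\<close> carries \<open>{1..}\<close>
  onto \<open>{..c - 1}\<close>, and \<open>c \<le> 1\<close> keeps the two half-lines disjoint.
  Their union misses only 0 when \<open>c = 0\<close> and nothing when \<open>c = 1\<close>.\<close>

lemma infsum_Un_reflect:
  fixes f :: "int \<Rightarrow> real"
  assumes "f summable_on UNIV"
  shows "c \<le> 1 \<Longrightarrow> infsum f {1..} + infsum (\<lambda>n. f (c - n)) {1..} = infsum f ({1..} \<union> {..c - 1})"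
    and "(\<lambda>n. f (c - n)) summable_on {1..}"
proof -
  have bij: "bij_betw (\<lambda>n. c - n) {1..} {..c - 1}"
    by (rule bij_betwI[where g = "\<lambda>n. c - n"]) auto
  have sub: "f summable_on A" for A
    using assms summable_on_subset_banach by blast
  show "(\<lambda>n. f (c - n)) summable_on {1..}"
    using summable_on_reindex_bij_betw[OF bij, of f] sub by simp
  show "infsum f {1..} + infsum (\<lambda>n. f (c - n)) {1..} = infsum f ({1..} \<union> {..c - 1})" if "c \<le> 1"
    using infsum_reindex_bij_betw[OF bij, of f] that
    by (subst infsum_Un_disjoint[OF sub sub]) auto
qed

lemma infsum_int_fold_0:
  fixes f :: "int \<Rightarrow> real"
  assumes "f summable_on UNIV"
  shows "infsum f UNIV = f 0 + infsum (\<lambda>n. f n + f (- n)) {1..}"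
    and "(\<lambda>n. f n + f (- n)) summable_on {1..}"
proof -
  have sub: "f summable_on A" for A
    using assms summable_on_subset_banach by blast
  have refl: "(\<lambda>n. f (- n)) summable_on {1..}"
    using infsum_Un_reflect(2)[OF assms, of 0] by simp
  have "UNIV = {0} \<union> ({1..} \<union> {..0 - 1 :: int})" by auto
  then have "infsum f UNIV = f 0 + infsum f ({1..} \<union> {..0 - 1})"
    by (subst \<open>UNIV = _\<close>, subst infsum_Un_disjoint[OF sub sub]) auto
  then show "infsum f UNIV = f 0 + infsum (\<lambda>n. f n + f (- n)) {1..}"
    using infsum_Un_reflect(1)[OF assms, of 0] by (simp add: infsum_add[OF sub refl])
  show "(\<lambda>n. f n + f (- n)) summable_on {1..}"
    by (intro summable_on_add sub refl)
qed

lemma infsum_int_fold_1: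
  fixes f :: "int \<Rightarrow> real"
  assumes "f summable_on UNIV"
  shows "infsum f UNIV = infsum (\<lambda>n. f n + f (1 - n)) {1..}"
    and "(\<lambda>n. f n + f (1 - n)) summable_on {1..}"
proof -
  have sub: "f summable_on A" for A
    using assms summable_on_subset_banach by blast
  note refl = infsum_Un_reflect(2)[OF assms, of 1]
  have "UNIV = {1..} \<union> {..1 - 1 :: int}" by auto
  then show "infsum f UNIV = infsum (\<lambda>n. f n + f (1 - n)) {1..}"
    using infsum_Un_reflect(1)[OF assms, of 1] by (simp add: infsum_add[OF sub refl])
  show "(\<lambda>n. f n + f (1 - n)) summable_on {1..}"
    by (intro summable_on_add sub refl)
qed

lemma summable_on_int_reflect:
  fixes f :: "int \<Rightarrow> real"
  assumes "f summable_on {k..}" and "\<And>n. f (c - n) = f n"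
  shows "f summable_on UNIV"
proof -
  have "bij_betw (\<lambda>n. c - n) {k..} {..c - k}"
    by (rule bij_betwI[where g = "\<lambda>n. c - n"]) auto
  then have "f summable_on {..c - k}"
    using summable_on_reindex_bij_betw[of "\<lambda>n. c - n" "{k..}" "{..c - k}" f] assms by simp
  \<comment> \<open>The middle interval is finite and bridges a possible gap between the half-lines.
    It is empty if \<open>c - k > k\<close>, but then they overlap.\<close>
  then have "f summable_on {..c - k} \<union> {c - k..k} \<union> {k..}"
    by (intro summable_on_union assms(1)) auto
  also have "{..c - k} \<union> {c - k..k} \<union> {k..} = UNIV" by auto
  finally show ?thesis .
qed

section \<open>Folding of symmetric double sums\<close>

text \<open>The row sums \<open>G\<close> are even, so the total is \<open>G 0\<close> plus twice
  the sum of \<open>G\<close> over \<open>{1..}\<close>. Folding a row gives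
  \<open>G n = F n 0 + H n\<close>, and by symmetry \<open>G 0\<close> is twice the sum of
  \<open>F n 0\<close>. Altogether \<open>F n 0\<close> is counted four times and \<open>H n\<close>
  twice, whence the factors 4 and 1/2.\<close>

lemma double_infsum_fold_0:
  fixes F :: "int \<Rightarrow> int \<Rightarrow> real"
  assumes sm: "(\<lambda>(n, m). F n m) summable_on UNIV"
    and sym: "\<And>n m. F n m = F m n" and refl: "\<And>n m. F (- n) (- m) = F n m"
    and F0: "F 0 0 = 0"
  shows "(\<lambda>m. F n m + F n (- m)) summable_on {1..}"
    and "(\<lambda>n. F n 0 + 1 / 2 * (\<Sum>\<^sub>\<infinity>m\<in>{1..}. F n m + F n (- m))) summable_on {1..}"
    and "(\<Sum>\<^sub>\<infinity>(n, m)\<in>UNIV. F n m)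
      = 4 * (\<Sum>\<^sub>\<infinity>n\<in>{1..}. F n 0 + 1 / 2 * (\<Sum>\<^sub>\<infinity>m\<in>{1..}. F n m + F n (- m)))"
proof -
  define G where "G n = infsum (F n) UNIV" for n
  define H where "H n = (\<Sum>\<^sub>\<infinity>m\<in>{1..}. F n m + F n (- m))" for n
  have sm': "(\<lambda>(n, m). F n m) summable_on UNIV \<times> UNIV" using sm by simp
  have sec: "F n summable_on UNIV" for n
    using summable_on_SigmaD1[OF sm'] by simp
  show "(\<lambda>m. F n m + F n (- m)) summable_on {1..}"
    by (rule infsum_int_fold_0[OF sec])
  have G: "G n = F n 0 + H n" for n
    unfolding G_def H_def by (rule infsum_int_fold_0[OF sec])
  have Gs: "G summable_on UNIV"
    using summable_on_Sigma_banach[OF sm'] by (simp add: G_def [abs_def])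
  have Gs1: "G summable_on {1..}"
    using Gs summable_on_subset_banach by blast
  have G_refl: "G (- n) = G n" for n
  proof -
    have "bij_betw uminus UNIV (UNIV :: int set)"
      by (rule bij_betwI[where g = uminus]) auto
    from infsum_reindex_bij_betw[OF this, of "F (- n)"] show ?thesis
      by (simp add: G_def refl)
  qed
  have F_0: "F 0 m + F 0 (- m) = 2 * F m 0" for m
    using refl[of 0 m] sym[of 0 m] by simp
  have F0s: "(\<lambda>n. F n 0) summable_on {1..}"
    using summable_on_subset_banach[OF sec[of 0], of "{1..}"] by (subst sym) simp
  have G0: "G 0 = 2 * (\<Sum>\<^sub>\<infinity>n\<in>{1..}. F n 0)"
    by (simp add: G H_def F0 F_0 infsum_cmult_right')
  \<comment> \<open>Eliminating \<open>H n\<close> leaves two families that are already known to be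
    summable.\<close>
  have eq: "F n 0 + 1 / 2 * H n = 1 / 2 * G n + 1 / 2 * F n 0" for n
    by (simp add: G field_simps)
  show "(\<lambda>n. F n 0 + 1 / 2 * (\<Sum>\<^sub>\<infinity>m\<in>{1..}. F n m + F n (- m))) summable_on {1..}"
    unfolding H_def[symmetric] eq by (intro summable_on_add summable_on_cmult_right Gs1 F0s)
  have "(\<Sum>\<^sub>\<infinity>(n, m)\<in>UNIV. F n m) = infsum G UNIV"
    using infsum_Sigma'_banach[OF sm'] by (simp add: G_def [abs_def])
  also have "\<dots> = 2 * (\<Sum>\<^sub>\<infinity>n\<in>{1..}. F n 0) + 2 * infsum G {1..}"
    by (simp add: infsum_int_fold_0[OF Gs] G_refl G0 infsum_cmult_right' flip: mult_2)
  also have "\<dots> = 4 * (\<Sum>\<^sub>\<infinity>n\<in>{1..}. 1 / 2 * G n + 1 / 2 * F n 0)"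
    by (subst infsum_add) (auto intro!: summable_on_cmult_right Gs1 F0s simp: infsum_cmult_right'
        simp del: times_divide_eq_left)
  finally show "(\<Sum>\<^sub>\<infinity>(n, m)\<in>UNIV. F n m)
      = 4 * (\<Sum>\<^sub>\<infinity>n\<in>{1..}. F n 0 + 1 / 2 * (\<Sum>\<^sub>\<infinity>m\<in>{1..}. F n m + F n (- m)))"
    unfolding H_def[symmetric] eq .
qed

text \<open>The sites 0 and 1 are mirror images and together act as the centre, with no interaction
  inside it by \<open>F1\<close>. The total is twice the sum of \<open>G\<close> over
  \<open>{1..}\<close>. Row 1 contributes the sum of \<open>F n 0 + F n 1\<close> over
  \<open>{2..}\<close>, and the other rows contribute it once more along with \<open>H n\<close>. So
  the central terms occur four times and \<open>H n\<close> twice.\<close>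

lemma double_infsum_fold_1:
  fixes F :: "int \<Rightarrow> int \<Rightarrow> real"
  assumes sm: "(\<lambda>(n, m). F n m) summable_on UNIV"
    and sym: "\<And>n m. F n m = F m n" and refl: "\<And>n m. F (1 - n) (1 - m) = F n m"
    and F1: "F 1 1 = 0" "F 1 0 = 0"
  shows "(\<lambda>m. F n m + F n (1 - m)) summable_on {2..}"
    and "(\<lambda>n. (F n 0 + F n 1) + 1 / 2 * (\<Sum>\<^sub>\<infinity>m\<in>{2..}. F n m + F n (1 - m))) summable_on {2..}"
    and "(\<Sum>\<^sub>\<infinity>(n, m)\<in>UNIV. F n m)
      = 4 * (\<Sum>\<^sub>\<infinity>n\<in>{2..}. (F n 0 + F n 1) + 1 / 2 * (\<Sum>\<^sub>\<infinity>m\<in>{2..}. F n m + F n (1 - m)))"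
proof -
  define G where "G n = infsum (F n) UNIV" for n
  define H where "H n = (\<Sum>\<^sub>\<infinity>m\<in>{2..}. F n m + F n (1 - m))" for n
  have sm': "(\<lambda>(n, m). F n m) summable_on UNIV \<times> UNIV" using sm by simp
  have sec: "F n summable_on UNIV" for n
    using summable_on_SigmaD1[OF sm'] by simp
  have split: "infsum f {1..} = f 1 + infsum f {2..}" if "f summable_on {1..}" for f :: "int \<Rightarrow> real"
  proof -
    have "f summable_on {2..}"
      using that by (rule summable_on_subset_banach) auto
    then have "infsum f ({1} \<union> {2..}) = f 1 + infsum f {2..}"
      by (subst infsum_Un_disjoint) auto
    moreover have "{1} \<union> {2..} = {1 :: int..}" by auto
    ultimately show ?thesis by simp
  qed
  show "(\<lambda>m. F n m + F n (1 - m)) summable_on {2..}"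
    using infsum_int_fold_1(2)[OF sec] by (rule summable_on_subset_banach) auto
  have G: "G n = F n 0 + F n 1 + H n" for n
    unfolding G_def H_def by (simp add: infsum_int_fold_1[OF sec] split)
  have Gs: "G summable_on UNIV"
    using summable_on_Sigma_banach[OF sm'] by (simp add: G_def [abs_def])
  have Gs1: "G summable_on A" for A
    using Gs summable_on_subset_banach by blast
  have G_refl: "G (1 - n) = G n" for n
  proof -
    have "bij_betw (\<lambda>m. 1 - m) UNIV (UNIV :: int set)"
      by (rule bij_betwI[where g = "\<lambda>m. 1 - m"]) auto
    from infsum_reindex_bij_betw[OF this, of "F (1 - n)"] show ?thesis
      by (simp add: G_def refl)
  qed
  \<comment> \<open>Reflection turns \<open>F 1 (1 - m)\<close> into \<open>F 0 m\<close>, so the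
    folded row 1 couples \<open>m\<close> to both central sites.\<close>
  have F_1: "F 1 m + F 1 (1 - m) = F m 0 + F m 1" for m
    using refl[of 0 m] sym[of 0 m] sym[of 1 m] by simp
  have F1s: "(\<lambda>n. F n 0 + F n 1) summable_on {2..}"
    using summable_on_subset_banach[OF summable_on_add[OF sec[of 0] sec[of 1]], of "{2..}"]
    by (subst (1 2) sym) simp
  have G1: "G 1 = (\<Sum>\<^sub>\<infinity>n\<in>{2..}. F n 0 + F n 1)"
    by (simp add: G H_def F1 F_1)
  have eq: "F n 0 + F n 1 + 1 / 2 * H n = 1 / 2 * G n + 1 / 2 * (F n 0 + F n 1)" for n
    by (simp add: G field_simps)
  show "(\<lambda>n. (F n 0 + F n 1) + 1 / 2 * (\<Sum>\<^sub>\<infinity>m\<in>{2..}. F n m + F n (1 - m))) summable_on {2..}"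
    unfolding H_def[symmetric] eq by (intro summable_on_add summable_on_cmult_right Gs1 F1s)
  have "(\<Sum>\<^sub>\<infinity>(n, m)\<in>UNIV. F n m) = infsum G UNIV"
    using infsum_Sigma'_banach[OF sm'] by (simp add: G_def [abs_def])
  also have "\<dots> = 2 * infsum G {1..}"
    by (simp add: infsum_int_fold_1[OF Gs] G_refl infsum_cmult_right' flip: mult_2)
  also have "\<dots> = 2 * (\<Sum>\<^sub>\<infinity>n\<in>{2..}. F n 0 + F n 1) + 2 * infsum G {2..}"
    by (simp add: split[OF Gs1] G1)
  also have "\<dots> = 4 * (\<Sum>\<^sub>\<infinity>n\<in>{2..}. 1 / 2 * G n + 1 / 2 * (F n 0 + F n 1))"
    by (subst infsum_add) (auto intro!: summable_on_cmult_right Gs1 F1s simp: infsum_cmult_right'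
        simp del: times_divide_eq_left)
  finally show "(\<Sum>\<^sub>\<infinity>(n, m)\<in>UNIV. F n m)
      = 4 * (\<Sum>\<^sub>\<infinity>n\<in>{2..}. (F n 0 + F n 1) + 1 / 2 * (\<Sum>\<^sub>\<infinity>m\<in>{2..}. F n m + F n (1 - m)))"
    unfolding H_def[symmetric] eq .
qed

section \<open>Summability of the recursively defined sequences\<close>

text \<open>Common form of both recursions, with \<open>c\<close> the parameter of the reflection.
  The source \<open>b\<close> holds the contribution of the site whose value is prescribed by a
  square root: site 0 for \<open>c = 0\<close>, site 1 for \<open>c = 1\<close>.\<close>

lemma recursion_l1:
  fixes J u b :: "int \<Rightarrow> real"
  assumes J: "J summable_on {1..}" "\<And>n. J n \<ge> 0"
    and pos: "\<epsilon> > 0" "\<omega> > 0" and c: "c \<ge> 0"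
    and b: "b summable_on {c + 1..}" "\<And>n. b n \<ge> 0"
    and rec: "\<And>n. n \<ge> c + 1 \<Longrightarrow> u n = \<epsilon> * (b n + (\<Sum>m\<in>{c + 1..n - 1}. (J (n - m) + J (n + m - c)) * u m))
      / (\<epsilon> * (2 * infsum J {1..} - J (2 * n - c)) + \<omega>)"
  shows "n \<ge> c + 1 \<Longrightarrow> u n \<ge> 0" and "u summable_on {c + 1..}"
proof -
  define T where "T = infsum J {1..}"
  define D where "D n = \<epsilon> * (2 * T - J (2 * n - c)) + \<omega>" for n
  have sumJ: "sum J A \<le> T" if "finite A" "A \<subseteq> {1..}" for A
    unfolding T_def using finite_sum_le_infsum[OF J(1) that] J(2) by simp
  \<comment> \<open>Here \<open>2 * n - c\<close> is at least 1, so its coupling is at most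
    \<open>T\<close> and the bracket in \<open>D n\<close> is at least \<open>T\<close>.\<close>
  have D_pos: "D n > 0" if "n \<ge> c + 1" for n
  proof -
    have "J (2 * n - c) \<le> T" "0 \<le> T"
      using sumJ[of "{2 * n - c}"] sumJ[of "{}"] that c by auto
    then show ?thesis unfolding D_def using pos by (intro add_nonneg_pos mult_nonneg_nonneg) auto
  qed
  have rec': "u n * D n = \<epsilon> * (b n + (\<Sum>m\<in>{c + 1..n - 1}. (J (n - m) + J (n + m - c)) * u m))"
    if "n \<ge> c + 1" for n
    using D_pos[OF that] rec[OF that] by (simp add: D_def T_def)
  have nonneg: "u n \<ge> 0" if "n \<ge> c + 1" for n
    using that
  proof (induction "nat n" arbitrary: n rule: less_induct)
    case less
    have "u m \<ge> 0" if "m \<in> {c + 1..n - 1}" for m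
      using that less.prems c by (intro less.hyps) auto
    then have "u n * D n \<ge> 0"
      unfolding rec'[OF less.prems] using pos J(2) b(2)
      by (intro mult_nonneg_nonneg add_nonneg_nonneg sum_nonneg) auto
    then show ?case
      using D_pos[OF less.prems] by (simp add: zero_le_mult_iff)
  qed
  then show "n \<ge> c + 1 \<Longrightarrow> u n \<ge> 0" .
  define B where "B = infsum b {c + 1..}"
  \<comment> \<open>The differences \<open>n - m\<close> run through \<open>{1..N - m}\<close>. The
    indices \<open>n + m - c\<close> start just above \<open>2 * m - c\<close>, so adding
    \<open>J (2 * m - c)\<close> still gives a sum over distinct positive indices, bounded by
    \<open>T\<close>.\<close>
  have weights: "(\<Sum>n\<in>{m + 1..N}. J (n - m) + J (n + m - c)) \<le> 2 * T - J (2 * m - c)"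
    if "m \<ge> c + 1" for m N
  proof -
    have "(\<Sum>n\<in>{m + 1..N}. J (n - m)) = sum J {1..N - m}"
      by (rule sum.reindex_bij_witness[where i = "\<lambda>n. n + m" and j = "\<lambda>n. n - m"]) auto
    moreover have "(\<Sum>n\<in>{m + 1..N}. J (n + m - c)) = sum J {2 * m + 1 - c..N + m - c}"
      by (rule sum.reindex_bij_witness[where i = "\<lambda>n. n - m + c" and j = "\<lambda>n. n + m - c"]) auto
    moreover have "J (2 * m - c) + sum J {2 * m + 1 - c..N + m - c}
        = sum J (insert (2 * m - c) {2 * m + 1 - c..N + m - c})"
      by (subst sum.insert) auto
    moreover have "sum J (insert (2 * m - c) {2 * m + 1 - c..N + m - c}) \<le> T"
      by (rule sumJ) (use that c in auto)
    moreover have "sum J {1..N - m} \<le> T" by (rule sumJ) auto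
    ultimately show ?thesis by (simp add: sum.distrib)
  qed
  have bound: "sum u {c + 1..N} \<le> \<epsilon> * B / \<omega>" for N
  proof -
    let ?A = "{c + 1..N}"
    \<comment> \<open>Both sides run over the triangle of pairs \<open>m < n\<close> in
      \<open>?A\<close>; the right one collects everything that \<open>u m\<close> feeds into later
      sites.\<close>
    have swap: "(\<Sum>n\<in>?A. \<Sum>m\<in>{c + 1..n - 1}. (J (n - m) + J (n + m - c)) * u m)
        = (\<Sum>m\<in>?A. (\<Sum>n\<in>{m + 1..N}. J (n - m) + J (n + m - c)) * u m)"
      unfolding sum_distrib_right
      by (subst (1 2) sum.Sigma)
        (auto intro!: sum.reindex_bij_witness[where i = prod.swap and j = prod.swap])
    have "(\<Sum>n\<in>?A. u n * D n)
        = \<epsilon> * ((\<Sum>n\<in>?A. b n) + (\<Sum>n\<in>?A. \<Sum>m\<in>{c + 1..n - 1}. (J (n - m) + J (n + m - c)) * u m))"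
      by (simp add: rec' sum.distrib sum_distrib_left distrib_left)
    also have "\<dots> \<le> \<epsilon> * (B + (\<Sum>m\<in>?A. (2 * T - J (2 * m - c)) * u m))"
      unfolding swap B_def using pos b
      by (intro mult_left_mono add_mono finite_sum_le_infsum sum_mono mult_right_mono weights nonneg) auto
    \<comment> \<open>The bound on the weights is \<open>D m\<close> without its summand \<omega>,
      up to the factor \<epsilon>. The sums of \<open>u n * D n\<close> therefore cancel, leaving a
      bound independent of \<open>N\<close>.\<close>
    also have "\<dots> = \<epsilon> * B + (\<Sum>n\<in>?A. u n * D n) - \<omega> * sum u ?A"
      by (simp add: D_def algebra_simps sum.distrib sum_distrib_left sum_subtractf)
    finally show ?thesis using pos by (simp add: field_simps)
  qed
  show "u summable_on {c + 1..}"
  proof (rule nonneg_bdd_above_summable_on)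
    show "u n \<ge> 0" if "n \<in> {c + 1..}" for n using that nonneg by simp
    show "bdd_above (sum u ` {F. F \<subseteq> {c + 1..} \<and> finite F})"
    proof (rule bdd_aboveI2)
      \<comment> \<open>Inserting 0 makes the maximum meaningful for empty \<open>F\<close> as
        well.\<close>
      fix F assume "F \<in> {F. F \<subseteq> {c + 1..} \<and> finite F}"
      then have "F \<subseteq> {c + 1..Max (insert 0 F)}" by auto
      then have "sum u F \<le> sum u {c + 1..Max (insert 0 F)}"
        by (intro sum_mono2) (auto intro: nonneg)
      also have "\<dots> \<le> \<epsilon> * B / \<omega>" by (rule bound)
      finally show "sum u F \<le> \<epsilon> * B / \<omega>" .
    qed
  qed
qed

section \<open>Couplings and powers of summable sequences\<close>

text \<open>True at every integer, since a real \<open>powr\<close> is either 0 or an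
  exponential.\<close>

lemma coupling_nonneg: "coupling \<alpha> n \<ge> 0"
  by (simp add: coupling_def)

lemma coupling_summable:
  assumes "\<alpha> > 0"
  shows "coupling \<alpha> summable_on {1..}"
proof -
  have "summable (\<lambda>n. real n powr (- (1 + \<alpha>)))"
    using assms by (subst summable_real_powr_iff) auto
  then have "(\<lambda>n. real n powr (- (1 + \<alpha>))) summable_on {1..}"
    by (intro summable_on_subset_banach[OF norm_summable_imp_summable_on]) auto
  moreover have "bij_betw int {1..} {1..}"
    by (rule bij_betwI[where g = nat]) auto
  ultimately show ?thesis
    using summable_on_reindex_bij_betw[of int "{1..}" "{1..}" "coupling \<alpha>"]
    by (simp add: coupling_def)
qed

text \<open>Each term is at most the whole sum, so \<open>u n ^ k\<close> is at most a constant
  times \<open>u n\<close>.\<close>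

lemma summable_on_power_of_nonneg:
  fixes u :: "'a \<Rightarrow> real"
  assumes "u summable_on A" and "\<And>n. n \<in> A \<Longrightarrow> u n \<ge> 0" and "k > 0"
  shows "(\<lambda>n. u n ^ k) summable_on A"
proof (rule summable_on_comparison_test)
  show "(\<lambda>n. infsum u A ^ (k - 1) * u n) summable_on A"
    by (intro summable_on_cmult_right assms)
  fix n assume n: "n \<in> A"
  then have "u n \<le> infsum u A"
    using finite_sum_le_infsum[OF assms(1), of "{n}"] assms(2) by simp
  then have "u n ^ (k - 1) * u n \<le> infsum u A ^ (k - 1) * u n"
    using assms(2)[OF n] by (intro mult_right_mono power_mono) auto
  then show "u n ^ k \<le> infsum u A ^ (k - 1) * u n"
    by (simp only: power_minus_mult[OF \<open>k > 0\<close>])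
  show "0 \<le> u n ^ k" using assms(2)[OF n] by simp
qed

section \<open>Absolute convergence of the energy\<close>

text \<open>On the diagonal this is \<open>0 / 0 = 0\<close>, so the pair sum may run over all of
  the product set, as Fubini's theorem and the folding require.\<close>

definition energy_density :: "real \<Rightarrow> (int \<Rightarrow> real) \<Rightarrow> int \<Rightarrow> int \<Rightarrow> real" where
  "energy_density \<alpha> u n m = \<bar>u n - u m\<bar>\<^sup>2 / real_of_int \<bar>n - m\<bar> powr (1 + \<alpha>)"

lemma energy_density_commute: "energy_density \<alpha> u n m = energy_density \<alpha> u m n"
  by (simp add: energy_density_def abs_minus_commute)

lemma energy_density_reflect:
  assumes "\<And>n. u (c - n) = u n"
  shows "energy_density \<alpha> u (c - n) (c - m) = energy_density \<alpha> u n m"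
  by (simp add: energy_density_def assms abs_minus_commute)

text \<open>The squared difference is at most \<open>2 * ((u n)\<^sup>2 + (u m)\<^sup>2)\<close>.
  Each of the two resulting double series is the sum of the squares times the sum of the even kernel
  \<open>K\<close>, where \<open>K 0 = 0\<close> by division by zero.\<close>

lemma energy_density_summable:
  assumes "\<alpha> > 0" and u: "(\<lambda>n. (u n)\<^sup>2) summable_on UNIV"
  shows "(\<lambda>(n, m). energy_density \<alpha> u n m) summable_on UNIV"
proof -
  define K where "K k = 1 / real_of_int \<bar>k\<bar> powr (1 + \<alpha>)" for k
  have "K summable_on {1..} \<longleftrightarrow> coupling \<alpha> summable_on {1..}"
    by (intro summable_on_cong) (simp only: K_def coupling_def powr_minus_divide, simp)
  then have K: "K summable_on UNIV"
    using coupling_summable[OF \<open>\<alpha> > 0\<close>]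
    by (intro summable_on_int_reflect[of _ 1 0]) (simp_all add: K_def)
  have "((\<lambda>m. (u n)\<^sup>2 * K (n - m)) has_sum (u n)\<^sup>2 * infsum K UNIV) UNIV" for n
  proof -
    have "bij_betw (\<lambda>m. n - m) UNIV UNIV"
      by (rule bij_betwI[where g = "\<lambda>m. n - m"]) auto
    from summable_on_reindex_bij_betw[OF this, of K] infsum_reindex_bij_betw[OF this, of K]
    show ?thesis
      using K by (intro has_sum_cmult_right) (simp add: has_sum_iff)
  qed
  then have 1: "(\<lambda>(n, m). (u n)\<^sup>2 * K (n - m)) summable_on UNIV \<times> UNIV"
    by (intro summable_on_SigmaI[where g = "\<lambda>n. (u n)\<^sup>2 * infsum K UNIV"] summable_on_cmult_left u)
      (auto simp: K_def)
  \<comment> \<open>Exchanging the coordinates gives the series in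
    \<open>(u m)\<^sup>2\<close>.\<close>
  have "bij_betw prod.swap (UNIV :: (int \<times> int) set) UNIV"
    by (rule bij_betwI[where g = prod.swap]) auto
  from summable_on_reindex_bij_betw[OF this, of "\<lambda>(n, m). (u n)\<^sup>2 * K (n - m)"] 1
  have 2: "(\<lambda>(n, m). (u m)\<^sup>2 * K (m - n)) summable_on UNIV"
    by (simp add: case_prod_unfold)
  have le: "(x - y)\<^sup>2 \<le> 2 * (x\<^sup>2 + y\<^sup>2)" for x y :: real
    using zero_le_power2[of "x + y"] by (simp add: power2_eq_square algebra_simps)
  show ?thesis
  proof (rule summable_on_comparison_test)
    show "(\<lambda>p. 2 * ((case p of (n, m) \<Rightarrow> (u n)\<^sup>2 * K (n - m)) + (case p of (n, m) \<Rightarrow> (u m)\<^sup>2 * K (m - n))))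
        summable_on UNIV"
      using 1 2 by (intro summable_on_cmult_right summable_on_add) auto
    fix p :: "int \<times> int"
    obtain n m where p: "p = (n, m)" by (cases p)
    have "(u n - u m)\<^sup>2 * K (n - m) \<le> 2 * ((u n)\<^sup>2 + (u m)\<^sup>2) * K (n - m)"
      by (intro mult_right_mono le) (simp add: K_def)
    then show "(case p of (n, m) \<Rightarrow> energy_density \<alpha> u n m)
        \<le> 2 * ((case p of (n, m) \<Rightarrow> (u n)\<^sup>2 * K (n - m)) + (case p of (n, m) \<Rightarrow> (u m)\<^sup>2 * K (m - n)))"
      by (simp add: p energy_density_def K_def abs_minus_commute algebra_simps add_divide_distrib)
    show "(case p of (n, m) \<Rightarrow> energy_density \<alpha> u n m) \<ge> 0"
      by (simp add: p energy_density_def)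
  qed
qed

lemma energy_eq_energy_density:
  "energy \<alpha> \<epsilon> u = \<epsilon> / 4 * (\<Sum>\<^sub>\<infinity>(n, m)\<in>UNIV. energy_density \<alpha> u n m) - 1 / 4 * (\<Sum>\<^sub>\<infinity>n. u n ^ 4)"
proof -
  have "(\<Sum>\<^sub>\<infinity>(n, m)\<in>{(n, m). n \<noteq> m}. \<bar>u n - u m\<bar>\<^sup>2 / real_of_int \<bar>n - m\<bar> powr (1 + \<alpha>))
      = (\<Sum>\<^sub>\<infinity>(n, m)\<in>UNIV. energy_density \<alpha> u n m)"
    by (rule infsum_cong_neutral) (auto simp: energy_density_def)
  then show ?thesis by (simp add: energy_def)
qed

lemma energy_converges_l2:
  assumes "\<alpha> > 0" and "(\<lambda>n. (u n)\<^sup>2) summable_on UNIV" and "(\<lambda>n. u n ^ 4) summable_on UNIV"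
  shows "energy_converges \<alpha> u"
proof -
  have "(\<lambda>(n, m). \<bar>u n - u m\<bar>\<^sup>2 / real_of_int \<bar>n - m\<bar> powr (1 + \<alpha>)) summable_on {(n, m). n \<noteq> m}"
    using summable_on_subset_banach[OF energy_density_summable[OF assms(1,2)]]
    by (simp add: energy_density_def)
  then show ?thesis using assms(3) by (simp add: energy_converges_def)
qed

section \<open>Nonnegativity and summability of the two sequences\<close>

lemma on_site_nonneg_summable:
  assumes "\<alpha> > 0" and "\<epsilon> > 0" and "\<omega> > 0"
  shows "on_site \<alpha> \<epsilon> \<omega> n \<ge> 0" and "on_site \<alpha> \<epsilon> \<omega> summable_on UNIV"
proof -
  let ?q = "on_site \<alpha> \<epsilon> \<omega>"
  have "coupling_total \<alpha> \<ge> 0"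
    unfolding coupling_total_def by (intro infsum_nonneg coupling_nonneg)
  then have q0: "?q 0 \<ge> 0"
    using assms by (simp add: on_site_0)
  \<comment> \<open>The forms \<open>0 + 1\<close> and \<open>- 0\<close> exhibit the case
    \<open>c = 0\<close> of \<open>recursion_l1\<close> literally.\<close>
  have rec: "?q n = \<epsilon> * (coupling \<alpha> n * ?q 0
      + (\<Sum>m\<in>{0 + 1..n - 1}. (coupling \<alpha> (n - m) + coupling \<alpha> (n + m - 0)) * ?q m))
      / (\<epsilon> * (2 * infsum (coupling \<alpha>) {1..} - coupling \<alpha> (2 * n - 0)) + \<omega>)" if "n \<ge> 0 + 1" for n
    using on_site_pos[of n] that by (simp add: coupling_total_def)
  have b: "(\<lambda>n. coupling \<alpha> n * ?q 0) summable_on {0 + 1..}"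
    using coupling_summable[OF assms(1)] by (intro summable_on_cmult_left) simp
  note l1 = recursion_l1[OF coupling_summable[OF assms(1)] coupling_nonneg assms(2,3) order_refl
      b mult_nonneg_nonneg[OF coupling_nonneg q0] rec]
  show "?q n \<ge> 0"
    using l1(1)[of n] l1(1)[of "- n"] q0 on_site_minus[of \<alpha> \<epsilon> \<omega> n]
    by (cases n "0 :: int" rule: linorder_cases) auto
  show "?q summable_on UNIV"
    using l1(2) by (rule summable_on_int_reflect[where c = 0]) (simp_all add: on_site_minus)
qed

lemma off_site_nonneg_summable:
  assumes "\<alpha> > 0" and "\<epsilon> > 0" and "\<omega> > 0"
  shows "off_site \<alpha> \<epsilon> \<omega> n \<ge> 0" and "off_site \<alpha> \<epsilon> \<omega> summable_on UNIV"
proof -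
  let ?g = "off_site \<alpha> \<epsilon> \<omega>" and ?J = "coupling \<alpha>"
  have Js: "?J summable_on A" if "A \<subseteq> {1..}" for A
    using coupling_summable[OF assms(1)] that by (rule summable_on_subset_banach)
  \<comment> \<open>Bounding the first coupling by the total keeps the radicand of
    \<open>?g 1\<close> nonnegative.\<close>
  have "sum ?J {1} \<le> coupling_total \<alpha>"
    unfolding coupling_total_def by (rule finite_sum_le_infsum[OF Js]) (auto simp: coupling_nonneg)
  then have "2 * coupling_total \<alpha> - ?J 1 \<ge> 0"
    using coupling_nonneg[of \<alpha> 1] by simp
  then have g1: "?g 1 \<ge> 0"
    unfolding off_site_1 using assms by simp
  \<comment> \<open>This is the term \<open>m = 1\<close> of the recursion, as
    \<open>n + 1 - 1 = n\<close>; the remaining sum starts at \<open>c + 1 = 2\<close>.\<close>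
  define b where "b n = (?J (n - 1) + ?J n) * ?g 1" for n
  have rec: "?g n = \<epsilon> * (b n + (\<Sum>m\<in>{1 + 1..n - 1}. (?J (n - m) + ?J (n + m - 1)) * ?g m))
      / (\<epsilon> * (2 * infsum ?J {1..} - ?J (2 * n - 1)) + \<omega>)" if "n \<ge> 1 + 1" for n
  proof -
    have "{1..n - 1} = insert 1 {1 + 1..n - 1}" using that by auto
    then show ?thesis
      using off_site_ge_2[of n] that by (simp add: coupling_total_def b_def)
  qed
  have "bij_betw (\<lambda>n. n - 1) {2..} {1 :: int..}"
    by (rule bij_betwI[where g = "\<lambda>n. n + 1"]) auto
  from summable_on_reindex_bij_betw[OF this, of ?J]
  have "b summable_on {1 + 1..}"
    unfolding b_def [abs_def] by (intro summable_on_cmult_left summable_on_add) (auto intro: Js)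
  note l1 = recursion_l1[OF coupling_summable[OF assms(1)] coupling_nonneg assms(2,3) zero_le_one
      this _ rec]
  have b_nonneg: "b n \<ge> 0" for n
    unfolding b_def by (intro mult_nonneg_nonneg add_nonneg_nonneg coupling_nonneg g1)
  have refl: "?g (1 - n) = ?g n" for n
    using off_site_reflect[of \<alpha> \<epsilon> \<omega> n] by simp
  have "?g n \<ge> 0" if "n \<ge> 1" for n
    using l1(1)[OF b_nonneg, of n] g1 that by (cases "n = 1") auto
  \<comment> \<open>Exactly one of \<open>n\<close> and \<open>1 - n\<close> is at least 1.\<close>
  from this[of n] this[of "1 - n"] show "?g n \<ge> 0"
    using refl[of n] by (cases "n \<ge> 1") auto
  show "?g summable_on UNIV"
    using l1(2)[OF b_nonneg] by (rule summable_on_int_reflect[where c = 1]) (simp_all add: refl)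
qed

section \<open>Folding the energy onto the half-line\<close>

lemma energy_fold_0:
  assumes "\<alpha> > 0" and u2: "(\<lambda>n. (u n)\<^sup>2) summable_on UNIV" and u4: "(\<lambda>n. u n ^ 4) summable_on UNIV"
    and refl: "\<And>n. u (- n) = u n"
  defines "h \<equiv> \<lambda>n m. (1 / real_of_int \<bar>n - m\<bar> powr (1 + \<alpha>) + 1 / real_of_int \<bar>n + m\<bar> powr (1 + \<alpha>)) * \<bar>u n - u m\<bar>\<^sup>2"
  defines "d \<equiv> \<lambda>n. \<bar>u n - u 0\<bar>\<^sup>2 / real_of_int n powr (1 + \<alpha>) + 1 / 2 * infsum (h n) {m. m \<ge> 1 \<and> m \<noteq> n}"
  shows "h n summable_on {m. m \<ge> 1 \<and> m \<noteq> n}" and "d summable_on {1..}"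
    and "energy \<alpha> \<epsilon> u = \<epsilon> * infsum d {1..} - (1 / 4 * u 0 ^ 4 + 1 / 2 * (\<Sum>\<^sub>\<infinity>n\<in>{1..}. u n ^ 4))"
proof -
  let ?F = "energy_density \<alpha> u"
  have Frefl: "?F (- n) (- m) = ?F n m" for n m
    using energy_density_reflect[of u 0] refl by simp
  note fold = double_infsum_fold_0[where F = ?F, OF energy_density_summable[OF assms(1) u2]
      energy_density_commute Frefl]
  have F0: "?F 0 0 = 0" by (simp add: energy_density_def)
  have h: "?F n m + ?F n (- m) = h n m" for n m
    by (simp add: h_def energy_density_def refl distrib_right)
  have "h n summable_on {m. m \<ge> 1 \<and> m \<noteq> n}" for n
    using fold(1)[OF F0, of n] unfolding h by (rule summable_on_subset_banach) auto
  then show "h n summable_on {m. m \<ge> 1 \<and> m \<noteq> n}" .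
  \<comment> \<open>The term \<open>m = n\<close> vanishes with the factor \<open>u n - u m\<close>,
    even though \<open>n + m\<close> need not be 0.\<close>
  have "infsum (h n) {1..} = infsum (h n) {m. m \<ge> 1 \<and> m \<noteq> n}" for n
    by (rule infsum_cong_neutral) (auto simp: h_def)
  then have d: "?F n 0 + 1 / 2 * (\<Sum>\<^sub>\<infinity>m\<in>{1..}. ?F n m + ?F n (- m)) = d n" if "n \<in> {1..}" for n
    using that unfolding h by (simp add: d_def energy_density_def)
  show "d summable_on {1..}"
    using summable_on_cong[THEN iffD1, OF d fold(2)[OF F0]] .
  \<comment> \<open>This 4 cancels the prefactor \<open>\<epsilon> / 4\<close> of the
    energy.\<close>
  have "(\<Sum>\<^sub>\<infinity>(n, m)\<in>UNIV. ?F n m) = 4 * infsum d {1..}"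
    unfolding fold(3)[OF F0] by (intro arg_cong[where f = "\<lambda>x. 4 * x"] infsum_cong d)
  then show "energy \<alpha> \<epsilon> u = \<epsilon> * infsum d {1..} - (1 / 4 * u 0 ^ 4 + 1 / 2 * (\<Sum>\<^sub>\<infinity>n\<in>{1..}. u n ^ 4))"
    unfolding energy_eq_energy_density infsum_int_fold_0(1)[OF u4]
    by (simp add: refl infsum_cmult_right' add_divide_distrib flip: mult_2)
qed

lemma energy_fold_1:
  assumes "\<alpha> > 0" and u2: "(\<lambda>n. (u n)\<^sup>2) summable_on UNIV" and u4: "(\<lambda>n. u n ^ 4) summable_on UNIV"
    and refl: "\<And>n. u (1 - n) = u n"
  defines "h \<equiv> \<lambda>n m. (1 / real_of_int \<bar>n - m\<bar> powr (1 + \<alpha>) + 1 / real_of_int \<bar>n + m - 1\<bar> powr (1 + \<alpha>)) * \<bar>u n - u m\<bar>\<^sup>2"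
  defines "d \<equiv> \<lambda>n. (1 / real_of_int n powr (1 + \<alpha>) + 1 / real_of_int (n - 1) powr (1 + \<alpha>)) * \<bar>u n - u 0\<bar>\<^sup>2
    + 1 / 2 * infsum (h n) {m. m \<ge> 2 \<and> m \<noteq> n}"
  shows "h n summable_on {m. m \<ge> 2 \<and> m \<noteq> n}" and "d summable_on {2..}"
    and "energy \<alpha> \<epsilon> u = \<epsilon> * infsum d {2..} - 1 / 2 * (\<Sum>\<^sub>\<infinity>n\<in>{1..}. u n ^ 4)"
proof -
  let ?F = "energy_density \<alpha> u"
  have Frefl: "?F (1 - n) (1 - m) = ?F n m" for n m
    using energy_density_reflect[of u 1] refl by simp
  note fold = double_infsum_fold_1[where F = ?F, OF energy_density_summable[OF assms(1) u2]
      energy_density_commute Frefl]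
  \<comment> \<open>Equal central values remove the interaction between the sites 0 and 1. They also
    let \<open>?F n 0\<close> and \<open>?F n 1\<close> share one squared difference, with weights
    at the distances \<open>n\<close> and \<open>n - 1\<close>.\<close>
  have u1: "u 1 = u 0" using refl[of 0] by simp
  have F1: "?F 1 1 = 0" "?F 1 0 = 0" by (simp_all add: energy_density_def u1)
  have h: "?F n m + ?F n (1 - m) = h n m" for n m
    by (simp add: h_def energy_density_def refl algebra_simps)
  have "h n summable_on {m. m \<ge> 2 \<and> m \<noteq> n}" for n
    using fold(1)[OF F1, of n] unfolding h by (rule summable_on_subset_banach) auto
  then show "h n summable_on {m. m \<ge> 2 \<and> m \<noteq> n}" .
  have "infsum (h n) {2..} = infsum (h n) {m. m \<ge> 2 \<and> m \<noteq> n}" for n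
    by (rule infsum_cong_neutral) (auto simp: h_def)
  then have d: "?F n 0 + ?F n 1 + 1 / 2 * (\<Sum>\<^sub>\<infinity>m\<in>{2..}. ?F n m + ?F n (1 - m)) = d n" if "n \<in> {2..}" for n
    using that unfolding h by (simp add: d_def energy_density_def u1 distrib_right)
  show "d summable_on {2..}"
    using summable_on_cong[THEN iffD1, OF d fold(2)[OF F1]] .
  have "(\<Sum>\<^sub>\<infinity>(n, m)\<in>UNIV. ?F n m) = 4 * infsum d {2..}"
    unfolding fold(3)[OF F1] by (intro arg_cong[where f = "\<lambda>x. 4 * x"] infsum_cong d)
  then show "energy \<alpha> \<epsilon> u = \<epsilon> * infsum d {2..} - 1 / 2 * (\<Sum>\<^sub>\<infinity>n\<in>{1..}. u n ^ 4)"
    unfolding energy_eq_energy_density infsum_int_fold_1(1)[OF u4]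
    by (simp add: refl infsum_cmult_right' flip: mult_2)
qed

text \<open>The summability claims accompany the identities because \<open>infsum\<close> is 0 for a
  divergent series; they ensure that every sum involved is a genuine value.\<close>

theorem proposition5p7:
  fixes \<alpha> \<epsilon> \<omega>A \<omega>B EA EB :: real
    and q g :: "int \<Rightarrow> real"
  assumes "\<alpha> > 0" and "\<epsilon> > 0" and "\<omega>A > 0" and "\<omega>B > 0"
  defines "q \<equiv> on_site \<alpha> \<epsilon> \<omega>A"
    and "g \<equiv> off_site \<alpha> \<epsilon> \<omega>B"
  defines "EA \<equiv> energy \<alpha> \<epsilon> q"
    and "EB \<equiv> energy \<alpha> \<epsilon> g"
  shows "energy_converges \<alpha> q
    \<and> energy_converges \<alpha> g
    \<and> (\<forall>n\<ge>1. (\<lambda>m. (1 / real_of_int \<bar>n - m\<bar> powr (1 + \<alpha>) + 1 / real_of_int \<bar>n + m\<bar> powr (1 + \<alpha>))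
        * \<bar>q n - q m\<bar>\<^sup>2) summable_on {m. m \<ge> 1 \<and> m \<noteq> n})
    \<and> ((\<lambda>n. \<bar>q n - q 0\<bar>\<^sup>2 / real_of_int n powr (1 + \<alpha>)
        + 1 / 2 * (\<Sum>\<^sub>\<infinity>m\<in>{m. m \<ge> 1 \<and> m \<noteq> n}.
            (1 / real_of_int \<bar>n - m\<bar> powr (1 + \<alpha>) + 1 / real_of_int \<bar>n + m\<bar> powr (1 + \<alpha>))
            * \<bar>q n - q m\<bar>\<^sup>2)) summable_on {1..})
    \<and> ((\<lambda>n. q n ^ 4) summable_on {1..})
    \<and> (\<forall>n\<ge>2. (\<lambda>m. (1 / real_of_int \<bar>n - m\<bar> powr (1 + \<alpha>) + 1 / real_of_int \<bar>n + m - 1\<bar> powr (1 + \<alpha>))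
        * \<bar>g n - g m\<bar>\<^sup>2) summable_on {m. m \<ge> 2 \<and> m \<noteq> n})
    \<and> ((\<lambda>n. (1 / real_of_int n powr (1 + \<alpha>) + 1 / real_of_int (n - 1) powr (1 + \<alpha>)) * \<bar>g n - g 0\<bar>\<^sup>2
        + 1 / 2 * (\<Sum>\<^sub>\<infinity>m\<in>{m. m \<ge> 2 \<and> m \<noteq> n}.
            (1 / real_of_int \<bar>n - m\<bar> powr (1 + \<alpha>) + 1 / real_of_int \<bar>n + m - 1\<bar> powr (1 + \<alpha>))
            * \<bar>g n - g m\<bar>\<^sup>2)) summable_on {2..})
    \<and> ((\<lambda>n. g n ^ 4) summable_on {1..})
    \<and> (EA = \<epsilon> * (\<Sum>\<^sub>\<infinity>n\<in>{1..}. \<bar>q n - q 0\<bar>\<^sup>2 / real_of_int n powr (1 + \<alpha>)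
        + 1 / 2 * (\<Sum>\<^sub>\<infinity>m\<in>{m. m \<ge> 1 \<and> m \<noteq> n}.
            (1 / real_of_int \<bar>n - m\<bar> powr (1 + \<alpha>) + 1 / real_of_int \<bar>n + m\<bar> powr (1 + \<alpha>))
            * \<bar>q n - q m\<bar>\<^sup>2))
      - (1 / 4 * q 0 ^ 4 + 1 / 2 * (\<Sum>\<^sub>\<infinity>n\<in>{1..}. q n ^ 4)))
    \<and> (EB = \<epsilon> * (\<Sum>\<^sub>\<infinity>n\<in>{2..}.
          (1 / real_of_int n powr (1 + \<alpha>) + 1 / real_of_int (n - 1) powr (1 + \<alpha>)) * \<bar>g n - g 0\<bar>\<^sup>2
        + 1 / 2 * (\<Sum>\<^sub>\<infinity>m\<in>{m. m \<ge> 2 \<and> m \<noteq> n}.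
            (1 / real_of_int \<bar>n - m\<bar> powr (1 + \<alpha>) + 1 / real_of_int \<bar>n + m - 1\<bar> powr (1 + \<alpha>))
            * \<bar>g n - g m\<bar>\<^sup>2))
      - 1 / 2 * (\<Sum>\<^sub>\<infinity>n\<in>{1..}. g n ^ 4))"
proof -
  note q = on_site_nonneg_summable[OF assms(1,2,3), folded q_def]
  note g = off_site_nonneg_summable[OF assms(1,2,4), folded g_def]
  have qpow: "(\<lambda>n. q n ^ k) summable_on UNIV" if "k > 0" for k
    by (rule summable_on_power_of_nonneg[OF q(2)]) (use q that in auto)
  have gpow: "(\<lambda>n. g n ^ k) summable_on UNIV" if "k > 0" for k
    by (rule summable_on_power_of_nonneg[OF g(2)]) (use g that in auto)
  have q_refl: "q (- n) = q n" for n
    by (simp add: q_def on_site_minus)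
  have g_refl: "g (1 - n) = g n" for n
    using off_site_reflect[of \<alpha> \<epsilon> \<omega>B n] by (simp add: g_def)
  \<comment> \<open>Exponent 2 controls the pair interaction, exponent 4 the quartic term.\<close>
  have q24: "(\<lambda>n. (q n)\<^sup>2) summable_on UNIV" "(\<lambda>n. q n ^ 4) summable_on UNIV"
    by (rule qpow; simp)+
  have g24: "(\<lambda>n. (g n)\<^sup>2) summable_on UNIV" "(\<lambda>n. g n ^ 4) summable_on UNIV"
    by (rule gpow; simp)+
  note qE = energy_fold_0[where u = q, OF assms(1) q24 q_refl]
  note gE = energy_fold_1[where u = g, OF assms(1) g24 g_refl]
  show ?thesis
    unfolding EA_def EB_def
    by (intro conjI allI impI energy_converges_l2 assms(1) q24 g24 qE gE
        summable_on_subset_banach[OF q24(2)] summable_on_subset_banach[OF g24(2)] subset_UNIV)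
qed

end
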